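(* Let $\mathbf{x}:U\to\mathbb{R}^3$ be a wavefront, $\Omega$ a tangent moving basis of $\mathbf{x}$, and $\mathbf{p}\in\Sigma(\mathbf{x})$ with $\mathrm{rank}(D\mathbf{x}(\mathbf{p}))=1$, $K_\Omega(\mathbf{p})=0$ and $H_\Omega(\mathbf{p})<0$ (resp. $H_\Omega(\mathbf{p})>0$). Then the following statements are equivalent: (1) $\mathbf{x}$ is parallelly smoothable at $\mathbf{p}$. (2) $\lim_{(u,v)\to\mathbf{p}}H=+\infty$ or $\lim_{(u,v)\to\mathbf{p}}H=-\infty$. (3) $\lim_{(u,v)\to\mathbf{p}}k_1=+\infty$ or $\lim_{(u,v)\to\mathbf{p}}k_1=-\infty$ (resp. the same with $k_2$ in place of $k_1$). (4) There exists an open neighborhood $V$ of $\mathbf{p}$ on which $\lambda_\Omega$ does not change sign.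
   Context: All maps are $C^\infty$; $U\subset\mathbb{R}^2$ is open, with coordinates $(u,v)$. A smooth map $\mathbf{x}:U\to\mathbb{R}^3$ is a frontal if every $\mathbf{p}\in U$ has an open neighborhood $V_p\subset U$ with a smooth unit vector field $\mathbf{n}_p:V_p\to\mathbb{R}^3$ orthogonal to $\mathbf{x}_u,\mathbf{x}_v$; it is a wavefront (front) if moreover each $(\mathbf{x},\mathbf{n}_p)$ is an immersion into $\mathbb{R}^3\times S^2$. The singular set is $\Sigma(\mathbf{x})=\{\mathbf{p}\in U:\mathbf{x}\text{ is not immersive at }\mathbf{p}\}$. A tangent moving basis (tmb) of $\mathbf{x}$ is a smooth map $\Omega=(\mathbf{w}_1\ \mathbf{w}_2):U\to\mathcal{M}_{3\times2}(\mathbb{R})$ with linearly independent columns at each point and $\mathbf{x}_u,\mathbf{x}_v\in\mathrm{span}(\mathbf{w}_1,\mathbf{w}_2)$. Put $\mathbf{n}=\frac{\mathbf{w}_1\times\mathbf{w}_2}{\|\mathbf{w}_1\times\mathbf{w}_2\|}$, $\mathbf{I}_\Omega=\Omega^T\Omega$, $\mathbf{II}_\Omega=-\Omega^TD\mathbf{n}$, $\mu_\Omega=-\mathbf{II}_\Omega^T\mathbf{I}_\Omega^{-1}$, $\Lambda_\Omega=D\mathbf{x}^T\Omega\,\mathbf{I}_\Omega^{-1}$, $\lambda_\Omega=\det\Lambda_\Omega$, $K_\Omega=\det\mu_\Omega$, $H_\Omega=-\frac12\mathrm{tr}(\mu_\Omega\,\mathrm{adj}(\Lambda_\Omega))$.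 One has $D\mathbf{x}=\Omega\Lambda_\Omega^T$ and $D\mathbf{n}=\Omega\mu_\Omega^T$, so $\Sigma(\mathbf{x})=\lambda_\Omega^{-1}(0)$. The fundamental forms are $\begin{pmatrix} E & F \\ F & G \end{pmatrix}=D\mathbf{x}^TD\mathbf{x}$ and $\begin{pmatrix} e & f \\ f & g \end{pmatrix}=-D\mathbf{x}^TD\mathbf{n}$ on $U$; on $U\setminus\Sigma(\mathbf{x})$, $K=\frac{eg-f^2}{EG-F^2}$ and $H=\frac{eG+gE-2fF}{2(EG-F^2)}$ are the Gaussian and mean curvatures. On $U\setminus\Sigma(\mathbf{x})$: $k_1=H-\sqrt{H^2-K}$ and $k_2=H+\sqrt{H^2-K}$ where $\lambda_\Omega>0$; $k_1=H+\sqrt{H^2-K}$ and $k_2=H-\sqrt{H^2-K}$ where $\lambda_\Omega<0$. $\mathbf{x}$ is parallelly smoothable at $\mathbf{p}\in\Sigma(\mathbf{x})$ if there exist $\epsilon>0$ and an open neighborhood $V$ of $\mathbf{p}$ such that $\mathrm{rank}(D(\mathbf{x}+l\mathbf{n})(\mathbf{q}))=2$ for every $(\mathbf{q},l)\in V\times(0,\epsilon)$, or for every $(\mathbf{q},l)\in V\times(-\epsilon,0)$. Conventions: a function does not change sign on $V$ if it is $\ge0$ on all of $V$ or $\le0$ on all of $V$. Limits of $H,k_1,k_2$ are taken along $U\setminus\Sigma(\mathbf{x})$: $\lim_{(u,v)\to\mathbf{p}}\varphi=+\infty$ (resp. $-\infty$) means that for every $M>0$ there is a neighborhood $N$ of $\mathbf{p}$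 with $\varphi>M$ (resp. $\varphi<-M$) on $N\setminus\Sigma(\mathbf{x})$. *)

theory Defs
  imports "HOL-Analysis.Analysis"
begin

text \<open>Smoothness (of class \<open>C\<^sup>\<infinity>\<close>), meant for open sets \<open>S\<close>: the derivative is always the full one,
  \<^term>\<open>at x\<close>.\<close>

primrec higher_differentiable_on ::
    "'a::real_normed_vector set \<Rightarrow> ('a \<Rightarrow> 'b::real_normed_vector) \<Rightarrow> nat \<Rightarrow> bool" where
  "higher_differentiable_on S f 0 \<longleftrightarrow> continuous_on S f"
| "higher_differentiable_on S f (Suc k) \<longleftrightarrow>
     (\<forall>x\<in>S. f differentiable (at x)) \<and>
     (\<forall>v. higher_differentiable_on S (\<lambda>x. frechet_derivative f (at x) v) k)"

definition smooth_on :: "'a::real_normed_vector set \<Rightarrow> ('a \<Rightarrow> 'b::real_normed_vector) \<Rightarrow> bool" where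
  "smooth_on S f \<longleftrightarrow> (\<forall>k. higher_differentiable_on S f k)"

definition immersive_at :: "('a::real_normed_vector \<Rightarrow> 'b::real_normed_vector) \<Rightarrow> 'a \<Rightarrow> bool" where
  "immersive_at f p \<longleftrightarrow> f differentiable (at p) \<and> inj (frechet_derivative f (at p))"

text \<open>A \<open>3 \<times> 2\<close> matrix has type \<^typ>\<open>real^2^3\<close>. The columns of \<^term>\<open>jacobian x (at q)\<close> are the partial
  derivatives \<open>x\<^sub>u\<close>, \<open>x\<^sub>v\<close> at \<open>q\<close>.\<close>

definition unit_normal_on :: "(real^2) set \<Rightarrow> (real^2 \<Rightarrow> real^3) \<Rightarrow> (real^2 \<Rightarrow> real^3) \<Rightarrow> bool" where
  "unit_normal_on V x n \<longleftrightarrow> smooth_on V n \<and>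
     (\<forall>q\<in>V. norm (n q) = 1 \<and>
        orthogonal (n q) (column 1 (jacobian x (at q))) \<and>
        orthogonal (n q) (column 2 (jacobian x (at q))))"

definition frontal :: "(real^2) set \<Rightarrow> (real^2 \<Rightarrow> real^3) \<Rightarrow> bool" where
  "frontal U x \<longleftrightarrow> smooth_on U x \<and>
     (\<forall>p\<in>U. \<exists>V n. open V \<and> p \<in> V \<and> V \<subseteq> U \<and> unit_normal_on V x n)"

text \<open>The unit fields can be chosen so that each \<open>(x, n)\<close> is an immersion. Being an immersion into
  the submanifold \<open>\<real>\<^sup>3 \<times> S\<^sup>2\<close> is the same as being one into \<open>\<real>\<^sup>3 \<times> \<real>\<^sup>3\<close>.\<close>

definition wavefront :: "(real^2) set \<Rightarrow> (real^2 \<Rightarrow> real^3) \<Rightarrow> bool" where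
  "wavefront U x \<longleftrightarrow> frontal U x \<and>
     (\<forall>p\<in>U. \<exists>V n. open V \<and> p \<in> V \<and> V \<subseteq> U \<and> unit_normal_on V x n \<and>
        (\<forall>q\<in>V. immersive_at (\<lambda>r. (x r, n r)) q))"

definition singular_set :: "(real^2) set \<Rightarrow> (real^2 \<Rightarrow> real^3) \<Rightarrow> (real^2) set" where
  "singular_set U x = {p \<in> U. \<not> immersive_at x p}"

text \<open>The inequality of the columns is needed because \<^const>\<open>independent\<close> is a property of the set of
  columns, which collapses if they coincide.\<close>

definition tangent_moving_basis ::
    "(real^2) set \<Rightarrow> (real^2 \<Rightarrow> real^3) \<Rightarrow> (real^2 \<Rightarrow> real^2^3) \<Rightarrow> bool" where
  "tangent_moving_basis U x \<Omega> \<longleftrightarrow> smooth_on U \<Omega> \<and>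
     (\<forall>q\<in>U. column 1 (\<Omega> q) \<noteq> column 2 (\<Omega> q) \<and>
        independent {column 1 (\<Omega> q), column 2 (\<Omega> q)} \<and>
        column 1 (jacobian x (at q)) \<in> span {column 1 (\<Omega> q), column 2 (\<Omega> q)} \<and>
        column 2 (jacobian x (at q)) \<in> span {column 1 (\<Omega> q), column 2 (\<Omega> q)})"

definition tmb_normal :: "(real^2 \<Rightarrow> real^2^3) \<Rightarrow> real^2 \<Rightarrow> real^3" where
  "tmb_normal \<Omega> q = cross3 (column 1 (\<Omega> q)) (column 2 (\<Omega> q))
     /\<^sub>R norm (cross3 (column 1 (\<Omega> q)) (column 2 (\<Omega> q)))"

definition I_tmb :: "(real^2 \<Rightarrow> real^2^3) \<Rightarrow> real^2 \<Rightarrow> real^2^2" where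
  "I_tmb \<Omega> q = transpose (\<Omega> q) ** \<Omega> q"

definition II_tmb :: "(real^2 \<Rightarrow> real^2^3) \<Rightarrow> real^2 \<Rightarrow> real^2^2" where
  "II_tmb \<Omega> q = - (transpose (\<Omega> q) ** jacobian (tmb_normal \<Omega>) (at q))"

definition mu_tmb :: "(real^2 \<Rightarrow> real^2^3) \<Rightarrow> real^2 \<Rightarrow> real^2^2" where
  "mu_tmb \<Omega> q = - (transpose (II_tmb \<Omega> q) ** matrix_inv (I_tmb \<Omega> q))"

definition Lambda_tmb :: "(real^2 \<Rightarrow> real^3) \<Rightarrow> (real^2 \<Rightarrow> real^2^3) \<Rightarrow> real^2 \<Rightarrow> real^2^2" where
  "Lambda_tmb x \<Omega> q = transpose (jacobian x (at q)) ** \<Omega> q ** matrix_inv (I_tmb \<Omega> q)"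

definition lambda_tmb :: "(real^2 \<Rightarrow> real^3) \<Rightarrow> (real^2 \<Rightarrow> real^2^3) \<Rightarrow> real^2 \<Rightarrow> real" where
  "lambda_tmb x \<Omega> q = det (Lambda_tmb x \<Omega> q)"

definition adj2 :: "real^2^2 \<Rightarrow> real^2^2" where
  "adj2 A = vector [vector [A$2$2, - A$1$2], vector [- A$2$1, A$1$1]]"

lemma mult_adj2: "A ** adj2 A = mat (det A)" and adj2_mult: "adj2 A ** A = mat (det A)"
  by (simp_all add: adj2_def vec_eq_iff forall_2 matrix_matrix_mult_def sum_2 mat_def det_2)

definition K_tmb :: "(real^2 \<Rightarrow> real^2^3) \<Rightarrow> real^2 \<Rightarrow> real" where
  "K_tmb \<Omega> q = det (mu_tmb \<Omega> q)"

definition H_tmb :: "(real^2 \<Rightarrow> real^3) \<Rightarrow> (real^2 \<Rightarrow> real^2^3) \<Rightarrow> real^2 \<Rightarrow> real" where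
  "H_tmb x \<Omega> q = - (1/2) * trace (mu_tmb \<Omega> q ** adj2 (Lambda_tmb x \<Omega> q))"

definition first_form :: "(real^2 \<Rightarrow> real^3) \<Rightarrow> real^2 \<Rightarrow> real^2^2" where
  "first_form x q = transpose (jacobian x (at q)) ** jacobian x (at q)"

text \<open>The second form and all curvatures are taken with respect to the normal field of \<open>\<Omega>\<close>.\<close>

definition second_form :: "(real^2 \<Rightarrow> real^3) \<Rightarrow> (real^2 \<Rightarrow> real^2^3) \<Rightarrow> real^2 \<Rightarrow> real^2^2" where
  "second_form x \<Omega> q = - (transpose (jacobian x (at q)) ** jacobian (tmb_normal \<Omega>) (at q))"

text \<open>The four curvature functions below are meaningful only off the singular set.\<close>

definition gauss_curvature :: "(real^2 \<Rightarrow> real^3) \<Rightarrow> (real^2 \<Rightarrow> real^2^3) \<Rightarrow> real^2 \<Rightarrow> real" where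
  "gauss_curvature x \<Omega> q =
    (let E = first_form x q $ 1 $ 1; F = first_form x q $ 1 $ 2; G = first_form x q $ 2 $ 2;
         e = second_form x \<Omega> q $ 1 $ 1; f = second_form x \<Omega> q $ 1 $ 2; g = second_form x \<Omega> q $ 2 $ 2
     in (e * g - f\<^sup>2) / (E * G - F\<^sup>2))"

definition mean_curvature :: "(real^2 \<Rightarrow> real^3) \<Rightarrow> (real^2 \<Rightarrow> real^2^3) \<Rightarrow> real^2 \<Rightarrow> real" where
  "mean_curvature x \<Omega> q =
    (let E = first_form x q $ 1 $ 1; F = first_form x q $ 1 $ 2; G = first_form x q $ 2 $ 2;
         e = second_form x \<Omega> q $ 1 $ 1; f = second_form x \<Omega> q $ 1 $ 2; g = second_form x \<Omega> q $ 2 $ 2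
     in (e * G + g * E - 2 * f * F) / (2 * (E * G - F\<^sup>2)))"

definition k1 :: "(real^2 \<Rightarrow> real^3) \<Rightarrow> (real^2 \<Rightarrow> real^2^3) \<Rightarrow> real^2 \<Rightarrow> real" where
  "k1 x \<Omega> q =
    (let H = mean_curvature x \<Omega> q; K = gauss_curvature x \<Omega> q
     in if lambda_tmb x \<Omega> q > 0 then H - sqrt (H\<^sup>2 - K) else H + sqrt (H\<^sup>2 - K))"

definition k2 :: "(real^2 \<Rightarrow> real^3) \<Rightarrow> (real^2 \<Rightarrow> real^2^3) \<Rightarrow> real^2 \<Rightarrow> real" where
  "k2 x \<Omega> q =
    (let H = mean_curvature x \<Omega> q; K = gauss_curvature x \<Omega> q
     in if lambda_tmb x \<Omega> q > 0 then H + sqrt (H\<^sup>2 - K) else H - sqrt (H\<^sup>2 - K))"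

definition parallelly_smoothable_at ::
    "(real^2) set \<Rightarrow> (real^2 \<Rightarrow> real^3) \<Rightarrow> (real^2 \<Rightarrow> real^2^3) \<Rightarrow> real^2 \<Rightarrow> bool" where
  "parallelly_smoothable_at U x \<Omega> p \<longleftrightarrow>
    (\<exists>\<epsilon>>0. \<exists>V. open V \<and> p \<in> V \<and> V \<subseteq> U \<and>
      ((\<forall>q\<in>V. \<forall>l\<in>{0<..<\<epsilon>}. rank (jacobian (\<lambda>r. x r + l *\<^sub>R tmb_normal \<Omega> r) (at q)) = 2) \<or>
       (\<forall>q\<in>V. \<forall>l\<in>{-\<epsilon><..<0}. rank (jacobian (\<lambda>r. x r + l *\<^sub>R tmb_normal \<Omega> r) (at q)) = 2)))"

text \<open>If \<open>p\<close> is interior to the singular set, the filter \<^term>\<open>at p within (U - singular_set U x)\<close> is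
  trivial and the limit statement holds vacuously.\<close>

definition diverges_at_singularity ::
    "(real^2) set \<Rightarrow> (real^2 \<Rightarrow> real^3) \<Rightarrow> (real^2 \<Rightarrow> real) \<Rightarrow> real^2 \<Rightarrow> bool" where
  "diverges_at_singularity U x \<phi> p \<longleftrightarrow>
     filterlim \<phi> at_top (at p within (U - singular_set U x)) \<or>
     filterlim \<phi> at_bot (at p within (U - singular_set U x))"

definition no_sign_change_on :: "('a \<Rightarrow> real) \<Rightarrow> 'a set \<Rightarrow> bool" where
  "no_sign_change_on \<phi> V \<longleftrightarrow> (\<forall>q\<in>V. \<phi> q \<ge> 0) \<or> (\<forall>q\<in>V. \<phi> q \<le> 0)"

end

theory Submission
  imports Defs
begin

text \<open>
  Writing \<open>D x = \<Omega> \<Lambda>\<^sup>T\<close> and \<open>D n = \<Omega> \<mu>\<^sup>T\<close>, the parallel surface \<open>x + l n\<close> is immersive exactly where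
  \<open>det (\<Lambda> + l \<mu>) = \<lambda> - 2 l H\<^sub>\<Omega> + l\<^sup>2 K\<^sub>\<Omega>\<close> does not vanish, and off the singular set \<open>H = H\<^sub>\<Omega> / \<lambda>\<close>,
  \<open>K = K\<^sub>\<Omega> / \<lambda>\<close>; the sign convention for \<open>k\<^sub>1\<close> and \<open>k\<^sub>2\<close> makes them equal to
  \<open>(H\<^sub>\<Omega> \<mp> sqrt (H\<^sub>\<Omega>\<^sup>2 - \<lambda> K\<^sub>\<Omega>)) / \<lambda>\<close>. Each of these numerators is continuous with a nonzero value at \<open>p\<close> (for
  \<open>k\<^sub>1\<close> or \<open>k\<^sub>2\<close> according to the sign of \<open>H\<^sub>\<Omega>\<close>), so the quotient diverges to a single infinity iff \<open>\<lambda>\<close>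
  keeps its sign near \<open>p\<close>. For the parallel surfaces, near \<open>p\<close> the term \<open>-2 l H\<^sub>\<Omega>\<close> dominates
  \<open>l\<^sup>2 K\<^sub>\<Omega>\<close>: if \<open>\<lambda>\<close> has the same sign as this term the determinant cannot vanish, and if it has the
  opposite sign, arbitrarily close to \<open>p\<close>, the intermediate value theorem in \<open>l\<close> produces a zero.
\<close>

subsection \<open>Matrices of size 3 by 2 and 2 by 2\<close>

text \<open>\<open>matrix_inv\<close> chooses some two-sided inverse. Uniqueness of the inverse
  identifies that choice with the adjugate formula, on which the algebra and the continuity proofs
  below rest.\<close>

lemma matrix_inv_eq_adj2:
  fixes A :: "real^2^2"
  assumes "det A \<noteq> 0"
  shows "matrix_inv A = (1 / det A) *\<^sub>R adj2 A"
proof -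
  have "A ** ((1 / det A) *\<^sub>R adj2 A) = mat 1"
    using mult_adj2[of A] assms
    by (simp add: vec_eq_iff matrix_matrix_mult_def mat_def sum_2 forall_2 field_simps)
  moreover from this have "((1 / det A) *\<^sub>R adj2 A) ** A = mat 1"
    by (simp only: matrix_left_right_inverse)
  ultimately show ?thesis
    unfolding matrix_inv_def
    by (intro some_equality) (auto, metis matrix_mul_assoc matrix_mul_lid matrix_mul_rid)
qed

abbreviation columns_cross :: "real^2^3 \<Rightarrow> real^3" where
  "columns_cross W \<equiv> cross3 (column 1 W) (column 2 W)"

lemmas matrix_entry_simps = matrix_matrix_mult_def transpose_def column_def matrix_vector_mult_def
  vec_eq_iff forall_2 forall_3 sum_2 sum_3 cross_components inner_vec_def

lemma adj2_mult_vec: "adj2 A *v b = vector [A$2$2 * b$1 - A$1$2 * b$2, A$1$1 * b$2 - A$2$1 * b$1]"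
  by (simp add: adj2_def vec_eq_iff forall_2 matrix_vector_mult_def sum_2)

lemma transpose_mult_vec_2:
  fixes W :: "real^2^3"
  shows "transpose W *v v = vector [column 1 W \<bullet> v, column 2 W \<bullet> v]"
  by (simp add: vec_eq_iff forall_2 matrix_vector_mult_def transpose_def column_def inner_vec_def)

lemma mult_vec_2:
  fixes W :: "real^2^3"
  shows "W *v a = a$1 *\<^sub>R column 1 W + a$2 *\<^sub>R column 2 W"
  by (simp add: vec_eq_iff forall_3 matrix_vector_mult_def sum_2 column_def)

lemma gram_entry: "(transpose W ** W) $ i $ j = column i W \<bullet> column j W"
  for W :: "real^2^3"
  by (simp add: matrix_matrix_mult_def transpose_def column_def inner_vec_def)

text \<open>Lagrange's identity for the cross product. It turns independence of the columns into
  invertibility of the Gram matrix.\<close>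

lemma det_gram: "det (transpose W ** W) = columns_cross W \<bullet> columns_cross W"
  for W :: "real^2^3"
  using norm_cross_dot[of "column 1 W" "column 2 W"]
  by (simp add: det_2 gram_entry power_mult_distrib dot_square_norm inner_commute power2_eq_square algebra_simps)

text \<open>For \<open>W\<close> of full rank this is \<open>det (W\<^sup>T W)\<close> times the orthogonal projection onto the column space of \<open>W\<close>.\<close>

lemma adj_gram_projection:
  fixes W :: "real^2^3" and v :: "real^3"
  shows "W *v (adj2 (transpose W ** W) *v (transpose W *v v)) =
    det (transpose W ** W) *\<^sub>R v - (columns_cross W \<bullet> v) *\<^sub>R columns_cross W"
proof -
  let ?w1 = "column 1 W" and ?w2 = "column 2 W" and ?c = "columns_cross W"
  have "det (transpose W ** W) *\<^sub>R v - (?c \<bullet> v) *\<^sub>R ?c = - cross3 ?c (cross3 ?c v)"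
    by (simp add: det_gram Lagrange)
  \<comment> \<open>Repeated triple product expansion leaves a combination of the two columns whose
    coefficients are built from Gram entries, arranged as in the adjugate.\<close>
  also have "cross3 ?c v = (?w1 \<bullet> v) *\<^sub>R ?w2 - (?w2 \<bullet> v) *\<^sub>R ?w1"
    using cross_skew[of ?c v] by (simp add: Lagrange inner_commute)
  also have "cross3 ?c \<dots> = (?w1 \<bullet> v) *\<^sub>R cross3 ?c ?w2 - (?w2 \<bullet> v) *\<^sub>R cross3 ?c ?w1"
    by (simp add: Cross3.right_diff_distrib cross_mult_right)
  also have "cross3 ?c ?w2 = (?w1 \<bullet> ?w2) *\<^sub>R ?w2 - (?w2 \<bullet> ?w2) *\<^sub>R ?w1"
    using cross_skew[of ?c ?w2] by (simp add: Lagrange inner_commute)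
  also have "cross3 ?c ?w1 = (?w1 \<bullet> ?w1) *\<^sub>R ?w2 - (?w2 \<bullet> ?w1) *\<^sub>R ?w1"
    using cross_skew[of ?c ?w1] by (simp add: Lagrange inner_commute)
  finally show ?thesis
    by (simp add: mult_vec_2[of W] transpose_mult_vec_2 adj2_mult_vec gram_entry
        inner_commute algebra_simps del: transpose_matrix_vector)
qed

lemma gram_symmetric: "transpose (transpose W ** W) = transpose W ** (W :: real^'n^'m)"
  by (simp add: matrix_transpose_mul)

text \<open>With \<open>A = D x\<close> and \<open>A = D n\<close> this gives \<open>D x = \<Omega> \<Lambda>\<^sup>T\<close> and \<open>D n = \<Omega> \<mu>\<^sup>T\<close>.\<close>

lemma gram_projection:
  fixes W :: "real^2^3" and A :: "real^2^3"
  assumes c: "columns_cross W \<noteq> 0"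
    and orth: "columns_cross W \<bullet> column 1 A = 0" "columns_cross W \<bullet> column 2 A = 0"
  shows "W ** transpose (transpose A ** W ** matrix_inv (transpose W ** W)) = A"
proof -
  let ?S = "transpose W ** W"
  have d: "det ?S \<noteq> 0" using c by (simp add: det_gram)
  \<comment> \<open>The adjugate of the symmetric Gram matrix is symmetric, so transposing only
    reverses the order of the factors.\<close>
  have *: "transpose (transpose A ** W ** matrix_inv ?S) = (1 / det ?S) *\<^sub>R (adj2 ?S ** (transpose W ** A))"
  proof -
    have "transpose (adj2 ?S) = adj2 ?S"
      by (simp add: adj2_def matrix_entry_simps mult.commute)
    then show ?thesis
      unfolding matrix_inv_eq_adj2[OF d]
      by (simp add: matrix_transpose_mul transpose_scalar scalar_matrix_assoc matrix_scalar_ac flip: matrix_mul_assoc)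
  qed
  \<comment> \<open>Compare columns: column \<open>j\<close> of \<open>A\<close> is orthogonal to
    the cross product, so the projection fixes it.\<close>
  have "(W ** transpose (transpose A ** W ** matrix_inv ?S)) *v axis j 1 = A *v axis j 1" for j :: 2
  proof -
    have "columns_cross W \<bullet> column j A = 0" using orth exhaust_2[of j] by auto
    then have "W *v (adj2 ?S *v (transpose W *v column j A)) = det ?S *\<^sub>R column j A"
      using adj_gram_projection[of W "column j A"] by simp
    moreover have "(W ** transpose (transpose A ** W ** matrix_inv ?S)) *v axis j 1
      = (1 / det ?S) *\<^sub>R (W *v (adj2 ?S *v (transpose W *v (A *v axis j 1))))"
      unfolding * by (simp only: matrix_scalar_ac scaleR_matrix_vector_assoc[symmetric] matrix_vector_mul_assoc[symmetric])
    ultimately show ?thesis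
      using d by (simp only: matrix_vector_mult_basis) simp
  qed
  then show ?thesis
    by (simp add: matrix_vector_mult_basis column_def vec_eq_iff)
qed

text \<open>The Gram matrix of \<open>W\<close> is invertible, so \<open>W\<close> has trivial
  kernel and \<open>W ** M\<close> has the same kernel as \<open>M\<close>.\<close>

lemma inj_mult_full_rank:
  fixes W :: "real^2^3" and M :: "real^2^2"
  assumes c: "columns_cross W \<noteq> 0"
  shows "inj ((*v) (W ** M)) \<longleftrightarrow> det M \<noteq> 0"
proof -
  have d: "det (transpose W ** W) \<noteq> 0" using c by (simp add: det_gram)
  have W: "W *v v = 0 \<longleftrightarrow> v = 0" for v
  proof
    assume "W *v v = 0"
    then have "(transpose W ** W) *v v = 0"
      by (simp flip: matrix_vector_mul_assoc)
    then show "v = 0" using d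
      by (metis invertible_det_nz matrix_left_invertible_ker invertible_def)
  qed simp
  have "inj ((*v) (W ** M)) \<longleftrightarrow> (\<forall>v. (W ** M) *v v = 0 \<longrightarrow> v = 0)"
    by (metis matrix_left_invertible_ker matrix_left_invertible_injective)
  also have "\<dots> \<longleftrightarrow> (\<forall>v. M *v v = 0 \<longrightarrow> v = 0)"
    by (simp add: W flip: matrix_vector_mul_assoc)
  also have "\<dots> \<longleftrightarrow> det M \<noteq> 0"
    by (metis invertible_det_nz invertible_left_inverse matrix_left_invertible_ker)
  finally show ?thesis .
qed

text \<open>For \<open>L\<close> and \<open>m\<close> equal to \<open>Lambda_tmb\<close> and
  \<open>mu_tmb\<close>, the coefficient of \<open>l\<close> is \<open>-2 * H_tmb\<close> and that
  of \<open>l\<^sup>2\<close> is \<open>K_tmb\<close>.\<close>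

lemma det_pencil:
  fixes L m :: "real^2^2"
  shows "det (L + l *\<^sub>R m) = det L + l * trace (m ** adj2 L) + l\<^sup>2 * det m"
  by (simp add: adj2_def matrix_entry_simps det_2 trace_def power2_eq_square algebra_simps)

lemma symmetric_matrix_entry:
  assumes "transpose A = A"
  shows "A $ i $ j = A $ j $ i"
proof -
  have "A $ i $ j = transpose A $ j $ i" by (simp add: transpose_def)
  then show ?thesis by (simp add: assms)
qed

text \<open>\<open>I\<close> and \<open>J\<close> stand for the two fundamental forms and
  \<open>S\<close> for the Gram matrix of the basis. By symmetry of \<open>I\<close> and
  \<open>J\<close> the left side is \<open>trace (J ** adj2 I)\<close>, and multiplicativity of the
  adjugate explains the factor \<open>det (L ** S)\<close>.\<close>

lemma mean_numerator:
  fixes L S m :: "real^2^2"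
  defines "I \<equiv> L ** S ** transpose L" and "J \<equiv> - (L ** S ** transpose m)"
  assumes "transpose S = S" and "transpose J = J"
  shows "J$1$1 * I$2$2 + J$2$2 * I$1$1 - 2 * J$1$2 * I$1$2
    = - trace (m ** adj2 L) * det L * det S"
proof -
  define P where "P = L ** S"
  have "transpose I = I"
    unfolding I_def by (simp add: matrix_transpose_mul assms(3) matrix_mul_assoc)
  then have "I$2$1 = I$1$2" "J$2$1 = J$1$2"
    using assms(4) symmetric_matrix_entry by blast+
  then have "J$1$1 * I$2$2 + J$2$2 * I$1$1 - 2 * J$1$2 * I$1$2
    = J$1$1 * I$2$2 + J$2$2 * I$1$1 - J$1$2 * I$2$1 - J$2$1 * I$1$2" by simp
  also have "\<dots> = - trace (m ** adj2 L) * det P"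
    unfolding I_def J_def P_def[symmetric]
    by (simp add: adj2_def matrix_matrix_mult_def transpose_def sum_2 det_2 trace_def algebra_simps)
  finally show ?thesis by (simp add: P_def det_mul)
qed

text \<open>Symmetry makes the left side \<open>det J\<close>, and in dimension 2 the minus sign in
  \<open>J\<close> does not affect the determinant.\<close>

lemma gauss_numerator:
  fixes L S m :: "real^2^2"
  defines "J \<equiv> - (L ** S ** transpose m)"
  assumes "transpose J = J"
  shows "J$1$1 * J$2$2 - (J$1$2)\<^sup>2 = det L * det S * det m"
proof -
  have "J$2$1 = J$1$2"
    using assms(2) symmetric_matrix_entry by blast
  then have "J$1$1 * J$2$2 - (J$1$2)\<^sup>2 = det (L ** S ** transpose m)"
    by (simp add: det_2 power2_eq_square J_def)
  then show ?thesis by (simp add: det_mul)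
qed

subsection \<open>Symmetry of second derivatives\<close>

text \<open>The mean value theorem along \<open>v\<close> turns the second difference into a first
  difference of the derivative in direction \<open>v\<close>, which is then expanded to first order
  at \<open>q\<close>.\<close>

lemma second_difference_limit:
  fixes f :: "'a::real_normed_vector \<Rightarrow> real"
  assumes S: "open S" "q \<in> S"
    and f: "\<And>r. r \<in> S \<Longrightarrow> (f has_derivative f' r) (at r)"
    and D: "((\<lambda>r. f' r v) has_derivative D) (at q)"
  shows "((\<lambda>t. (f (q + t *\<^sub>R v + t *\<^sub>R w) - f (q + t *\<^sub>R v) - f (q + t *\<^sub>R w) + f q) / t\<^sup>2)
    \<longlongrightarrow> D w) (at_right 0)"
proof (rule tendstoI)
  fix e :: real assume "e > 0"
  \<comment> \<open>For \<open>0 \<le> s \<le> t\<close>, both \<open>s v\<close> and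
    \<open>s v + t w\<close> have norm at most \<open>t * C\<close>; the summand 1 keeps
    \<open>C\<close> positive. With the 4 in \<open>e'\<close>, two remainders of size
    \<open>e' * (t * C)\<close> add up to \<open>e * t / 2\<close>.\<close>
  define C where "C = 2 * norm v + norm w + 1"
  have C: "C > 0" by (simp add: C_def add_nonneg_pos)
  define e' where "e' = e / (4 * C)"
  have e': "e' > 0" using C \<open>e > 0\<close> by (simp add: e'_def)
  obtain d1 where d1: "d1 > 0"
    and d1b: "\<And>h. norm h < d1 \<Longrightarrow> norm (f' (q + h) v - f' q v - D h) \<le> e' * norm h"
    using D[unfolded has_derivative_at_alt] e' by (metis add_diff_cancel_left')
  obtain d2 where d2: "d2 > 0" "ball q d2 \<subseteq> S" using S openE by blast
  \<comment> \<open>For \<open>t < d\<close> the bound \<open>t * C\<close> lies below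
    \<open>d1\<close>, where the expansion of the derivative is valid, and below \<open>d2\<close>,
    which keeps all points in \<open>S\<close>.\<close>
  define d where "d = min d1 d2 / C"
  have "d > 0" using d1 d2 C by (simp add: d_def)
  have lin: "linear D" using D has_derivative_linear by blast
  have "dist ((f (q + t *\<^sub>R v + t *\<^sub>R w) - f (q + t *\<^sub>R v) - f (q + t *\<^sub>R w) + f q) / t\<^sup>2) (D w) < e"
    if t: "0 < t" "t < d" for t
  proof -
    have tC: "t * C < d1" "t * C < d2" using t C by (auto simp: d_def field_simps)
    have small: "norm (s *\<^sub>R v + t *\<^sub>R w) \<le> t * C" "norm (s *\<^sub>R v) \<le> t * C" if "0 \<le> s" "s \<le> t" for s
    proof -
      have "norm (s *\<^sub>R v + t *\<^sub>R w) \<le> s * norm v + t * norm w"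
        using norm_triangle_ineq[of "s *\<^sub>R v" "t *\<^sub>R w"] that t by simp
      also have "\<dots> \<le> t * norm v + t * norm w" using that by (simp add: mult_right_mono)
      also have "\<dots> \<le> t * C" using t by (simp add: C_def algebra_simps)
      finally show "norm (s *\<^sub>R v + t *\<^sub>R w) \<le> t * C" .
      have "norm (s *\<^sub>R v) \<le> t * norm v" using that by (simp add: mult_right_mono)
      also have "\<dots> \<le> t * C" using t by (simp add: C_def algebra_simps)
      finally show "norm (s *\<^sub>R v) \<le> t * C" .
    qed
    have inS: "q + s *\<^sub>R v + t *\<^sub>R w \<in> S" "q + s *\<^sub>R v \<in> S" if "0 \<le> s" "s \<le> t" for s
    proof -
      have "q + h \<in> ball q d2" if "norm h < d2" for h
        using that by (simp add: dist_norm)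
      then have "q + (s *\<^sub>R v + t *\<^sub>R w) \<in> ball q d2" "q + s *\<^sub>R v \<in> ball q d2"
        using small[OF that] tC by (blast intro: le_less_trans)+
      then show "q + s *\<^sub>R v + t *\<^sub>R w \<in> S" "q + s *\<^sub>R v \<in> S" using d2 by (auto simp: add.assoc)
    qed
    \<comment> \<open>The second difference equals \<open>?\<phi> t - ?\<phi> 0\<close>.\<close>
    let ?\<phi> = "\<lambda>s. f (q + s *\<^sub>R v + t *\<^sub>R w) - f (q + s *\<^sub>R v)"
    have "DERIV ?\<phi> s :> f' (q + s *\<^sub>R v + t *\<^sub>R w) v - f' (q + s *\<^sub>R v) v" if s: "0 \<le> s" "s \<le> t" for s
    proof -
      have 1: "((\<lambda>s. f (q + s *\<^sub>R v + t *\<^sub>R w)) has_derivative (\<lambda>h. f' (q + s *\<^sub>R v + t *\<^sub>R w) (h *\<^sub>R v))) (at s)"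
        by (rule has_derivative_compose[where g=f and f="\<lambda>s. q + s *\<^sub>R v + t *\<^sub>R w", OF _ f[OF inS(1)[OF s]]]) (auto intro!: derivative_eq_intros)
      have 2: "((\<lambda>s. f (q + s *\<^sub>R v)) has_derivative (\<lambda>h. f' (q + s *\<^sub>R v) (h *\<^sub>R v))) (at s)"
        by (rule has_derivative_compose[where g=f and f="\<lambda>s. q + s *\<^sub>R v", OF _ f[OF inS(2)[OF s]]]) (auto intro!: derivative_eq_intros)
      have "f' (q + s *\<^sub>R v + t *\<^sub>R w) (h *\<^sub>R v) - f' (q + s *\<^sub>R v) (h *\<^sub>R v)
        = (f' (q + s *\<^sub>R v + t *\<^sub>R w) v - f' (q + s *\<^sub>R v) v) * h" for h
        using f[OF inS(1)[OF s]] f[OF inS(2)[OF s]]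
        by (simp add: has_derivative_linear linear_scale algebra_simps)
      then show ?thesis using has_derivative_diff[OF 1 2]
        by (simp add: has_field_derivative_def mult_commute_abs)
    qed
    then obtain \<xi> where xi: "0 < \<xi>" "\<xi> < t"
      and mvt: "?\<phi> t - ?\<phi> 0 = (t - 0) * (f' (q + \<xi> *\<^sub>R v + t *\<^sub>R w) v - f' (q + \<xi> *\<^sub>R v) v)"
      using MVT2[of 0 t ?\<phi> "\<lambda>s. f' (q + s *\<^sub>R v + t *\<^sub>R w) v - f' (q + s *\<^sub>R v) v"] t(1) by blast
    \<comment> \<open>\<open>R\<close> is the remainder of the expansion at \<open>q\<close>. In the
      difference of the two expansions the terms \<open>D (\<xi> v)\<close> cancel, which leaves
      \<open>t * D w\<close>.\<close>
    define R where "R h = f' (q + h) v - f' q v - D h" for h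
    have R: "\<bar>R h\<bar> \<le> e' * (t * C)" if "norm h \<le> t * C" for h
    proof -
      have "\<bar>R h\<bar> \<le> e' * norm h" using d1b[of h] that tC unfolding R_def by auto
      also have "\<dots> \<le> e' * (t * C)" using that e' by simp
      finally show ?thesis .
    qed
    have "f' (q + \<xi> *\<^sub>R v + t *\<^sub>R w) v - f' (q + \<xi> *\<^sub>R v) v
      = t * D w + (R (\<xi> *\<^sub>R v + t *\<^sub>R w) - R (\<xi> *\<^sub>R v))"
      using lin by (simp add: R_def linear_add linear_scale add.assoc)
    then have "f (q + t *\<^sub>R v + t *\<^sub>R w) - f (q + t *\<^sub>R v) - f (q + t *\<^sub>R w) + f q
      = t * (t * D w + (R (\<xi> *\<^sub>R v + t *\<^sub>R w) - R (\<xi> *\<^sub>R v)))"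
      using mvt by simp
    then have "(f (q + t *\<^sub>R v + t *\<^sub>R w) - f (q + t *\<^sub>R v) - f (q + t *\<^sub>R w) + f q) / t\<^sup>2
      = D w + (R (\<xi> *\<^sub>R v + t *\<^sub>R w) - R (\<xi> *\<^sub>R v)) / t"
      using t by (simp only:) (simp add: field_simps power2_eq_square)
    moreover have "\<bar>(R (\<xi> *\<^sub>R v + t *\<^sub>R w) - R (\<xi> *\<^sub>R v)) / t\<bar> < e"
    proof -
      have "\<bar>R (\<xi> *\<^sub>R v + t *\<^sub>R w) - R (\<xi> *\<^sub>R v)\<bar> \<le> 2 * (e' * (t * C))"
        using R[of "\<xi> *\<^sub>R v + t *\<^sub>R w"] R[of "\<xi> *\<^sub>R v"] small[of \<xi>] xi by linarith
      also have "\<dots> < e * t" using C t \<open>e > 0\<close> by (simp add: e'_def)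
      finally show ?thesis using t by (simp add: abs_divide pos_divide_less_eq)
    qed
    ultimately show ?thesis by (simp add: dist_norm)
  qed
  then show "\<forall>\<^sub>F t in at_right 0. dist ((f (q + t *\<^sub>R v + t *\<^sub>R w) - f (q + t *\<^sub>R v) - f (q + t *\<^sub>R w) + f q) / t\<^sup>2) (D w) < e"
    using \<open>d > 0\<close> unfolding eventually_at_right_field by blast
qed

text \<open>The second difference is symmetric in \<open>v\<close> and \<open>w\<close>, so one
  quotient has both values as its limit.\<close>

lemma mixed_derivatives_commute_real:
  fixes f :: "'a::real_normed_vector \<Rightarrow> real"
  assumes S: "open S" "q \<in> S"
    and f: "\<And>r. r \<in> S \<Longrightarrow> (f has_derivative f' r) (at r)"
    and D: "((\<lambda>r. f' r v) has_derivative D) (at q)"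
    and E: "((\<lambda>r. f' r w) has_derivative E) (at q)"
  shows "D w = E v"
proof (rule tendsto_unique)
  let ?g = "\<lambda>t. (f (q + t *\<^sub>R v + t *\<^sub>R w) - f (q + t *\<^sub>R v) - f (q + t *\<^sub>R w) + f q) / t\<^sup>2"
  show "(?g \<longlongrightarrow> D w) (at_right 0)" by (rule second_difference_limit[OF S f D])
  have "?g = (\<lambda>t. (f (q + t *\<^sub>R w + t *\<^sub>R v) - f (q + t *\<^sub>R w) - f (q + t *\<^sub>R v) + f q) / t\<^sup>2)"
    by (simp add: algebra_simps)
  then show "(?g \<longlongrightarrow> E v) (at_right 0)" using second_difference_limit[OF S f E] by simp
qed (rule trivial_limit_at_right_real)

lemma mixed_derivatives_commute:
  fixes f :: "'a::real_normed_vector \<Rightarrow> 'b::euclidean_space"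
  assumes S: "open S" "q \<in> S"
    and f: "\<And>r. r \<in> S \<Longrightarrow> (f has_derivative f' r) (at r)"
    and D: "((\<lambda>r. f' r v) has_derivative D) (at q)"
    and E: "((\<lambda>r. f' r w) has_derivative E) (at q)"
  shows "D w = E v"
proof (rule euclidean_eqI)
  fix b :: 'b assume "b \<in> Basis"
  show "D w \<bullet> b = E v \<bullet> b"
    by (rule mixed_derivatives_commute_real[OF S, of "\<lambda>r. f r \<bullet> b" "\<lambda>r h. f' r h \<bullet> b" v "\<lambda>h. D h \<bullet> b" w "\<lambda>h. E h \<bullet> b"])
      (use f D E in \<open>auto intro: has_derivative_inner_left\<close>)
qed

subsection \<open>Sign changes, divergence and roots near a zero\<close>

lemma eventually_quotient_pos:
  fixes L h \<phi> :: "'a::metric_space \<Rightarrow> real"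
  assumes "(h \<longlongrightarrow> c) F" "c > 0" "(L \<longlongrightarrow> 0) F" "\<forall>\<^sub>F q in F. L q > 0" "\<forall>\<^sub>F q in F. \<phi> q = h q / L q"
  shows "filterlim \<phi> at_top F"
proof -
  have "filterlim (\<lambda>q. inverse (L q)) at_top F"
    using assms filterlim_inverse_at_top by blast
  then have "filterlim (\<lambda>q. h q * inverse (L q)) at_top F"
    using assms filterlim_tendsto_pos_mult_at_top by blast
  then show ?thesis
    using assms(5) by (simp add: filterlim_cong[OF refl refl, of \<phi> "\<lambda>q. h q * inverse (L q)" F] divide_inverse)
qed

text \<open>Puncturing the neighborhood at \<open>p\<close> changes nothing, because
  \<open>L p = 0\<close> already excludes \<open>p\<close>.\<close>

lemma at_within_nonzero_eventually:
  fixes L :: "'a::topological_space \<Rightarrow> real"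
  assumes "open U" "p \<in> U" "L p = 0"
  shows "(\<forall>\<^sub>F q in at p within {q \<in> U. L q \<noteq> 0}. P q) \<longleftrightarrow> (\<forall>\<^sub>F q in nhds p. q \<in> U \<longrightarrow> L q \<noteq> 0 \<longrightarrow> P q)"
  unfolding eventually_at_filter using assms(3) by (auto elim!: eventually_mono)

text \<open>Near \<open>p\<close> the numerator keeps its sign, so the sign of the quotient is that
  of \<open>L\<close> up to a constant factor. If \<open>L\<close> vanishes near \<open>p\<close>,
  the filter is trivial and both sides hold.\<close>

lemma quotient_divergence_iff:
  fixes L h \<phi> :: "'a::metric_space \<Rightarrow> real"
  assumes U: "open U" "p \<in> U"
    and L: "continuous_on U L" "L p = 0"
    and h: "continuous_on U h" "h p \<noteq> 0"
    and \<phi>: "\<forall>\<^sub>F q in nhds p. L q \<noteq> 0 \<longrightarrow> \<phi> q = h q / L q"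
  shows "filterlim \<phi> at_top (at p within {q \<in> U. L q \<noteq> 0}) \<or> filterlim \<phi> at_bot (at p within {q \<in> U. L q \<noteq> 0})
    \<longleftrightarrow> (\<forall>\<^sub>F q in nhds p. L q \<ge> 0) \<or> (\<forall>\<^sub>F q in nhds p. L q \<le> 0)"
proof -
  \<comment> \<open>Stated for arbitrary \<open>h\<close>, \<open>L\<close> and
    \<open>\<phi>\<close>, so that it can be reused below after changes of sign.\<close>
  have pos: "filterlim \<phi> at_top (at p within {q \<in> U. L q \<noteq> 0}) \<longleftrightarrow> (\<forall>\<^sub>F q in nhds p. L q \<ge> 0)"
    if h: "continuous_on U h" "h p > 0" and L: "continuous_on U L" "L p = 0"
    and \<phi>: "\<forall>\<^sub>F q in nhds p. L q \<noteq> 0 \<longrightarrow> \<phi> q = h q / L q" for h L \<phi> :: "'a \<Rightarrow> real"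
  proof
    let ?F = "at p within {q \<in> U. L q \<noteq> 0}"
    have U_ev: "\<forall>\<^sub>F q in nhds p. q \<in> U" using U eventually_nhds by blast
    assume "filterlim \<phi> at_top ?F"
    then have "\<forall>\<^sub>F q in ?F. \<phi> q > 0" by (simp add: filterlim_at_top_dense)
    then have "\<forall>\<^sub>F q in nhds p. q \<in> U \<longrightarrow> L q \<noteq> 0 \<longrightarrow> \<phi> q > 0"
      by (simp add: at_within_nonzero_eventually U L)
    moreover have "\<forall>\<^sub>F q in nhds p. h q > 0"
    proof -
      have "isCont h p" using h U continuous_on_eq_continuous_at by blast
      then have "(h \<longlongrightarrow> h p) (nhds p)" by (simp add: isCont_def tendsto_at_iff_tendsto_nhds)
      then show ?thesis using h(2) order_tendstoD(1) by blast
    qed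
    ultimately show "\<forall>\<^sub>F q in nhds p. L q \<ge> 0"
      using \<phi> U_ev
    proof eventually_elim
      case (elim q)
      then show ?case by (cases "L q = 0") (auto simp: zero_less_divide_iff)
    qed
  next
    let ?F = "at p within {q \<in> U. L q \<noteq> 0}"
    assume "\<forall>\<^sub>F q in nhds p. L q \<ge> 0"
    then have "\<forall>\<^sub>F q in ?F. L q > 0"
      unfolding at_within_nonzero_eventually[where L=L, OF U L(2)] by eventually_elim auto
    moreover have "\<forall>\<^sub>F q in ?F. \<phi> q = h q / L q"
      unfolding at_within_nonzero_eventually[where L=L, OF U L(2)] using \<phi> by eventually_elim auto
    moreover have "(L \<longlongrightarrow> 0) ?F" "(h \<longlongrightarrow> h p) ?F"
      using L h(1) U by (metis (no_types, lifting) continuous_on_def mem_Collect_eq subsetI tendsto_within_subset)+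
    ultimately show "filterlim \<phi> at_top ?F"
      using h(2) eventually_quotient_pos by blast
  qed
  have sgn_pos: "sgn (h p) * h p > 0" using h(2) by (simp add: sgn_if)
  \<comment> \<open>Multiplying numerator and denominator by \<open>sgn (h p)\<close> keeps the
    quotient and makes the numerator positive at \<open>p\<close>.\<close>
  have top: "filterlim \<phi> at_top (at p within {q \<in> U. L q \<noteq> 0}) \<longleftrightarrow> (\<forall>\<^sub>F q in nhds p. sgn (h p) * L q \<ge> 0)"
    using pos[of "\<lambda>q. sgn (h p) * h q" "\<lambda>q. sgn (h p) * L q" \<phi>] h L \<phi> sgn_pos
    by (simp add: continuous_intros sgn_mult_self_eq sgn_0_0)
  \<comment> \<open>Divergence to minus infinity is handled by \<open>- \<phi>\<close>, obtained by
    also negating the denominator.\<close>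
  have bot: "filterlim \<phi> at_bot (at p within {q \<in> U. L q \<noteq> 0}) \<longleftrightarrow> (\<forall>\<^sub>F q in nhds p. sgn (h p) * L q \<le> 0)"
    using pos[of "\<lambda>q. sgn (h p) * h q" "\<lambda>q. - sgn (h p) * L q" "\<lambda>q. - \<phi> q"] h L \<phi> sgn_pos
    by (simp add: continuous_intros sgn_mult_self_eq sgn_0_0 filterlim_uminus_at_top)
  show ?thesis unfolding top bot using h(2) by (auto simp: sgn_if)
qed

text \<open>The model case \<open>H p < 0\<close>, \<open>l > 0\<close>. The other cases reduce to
  it by negating \<open>L\<close>, \<open>H\<close>, \<open>K\<close> or \<open>l\<close>.\<close>

lemma pencil_nonzero_iff:
  fixes L H K :: "'a::metric_space \<Rightarrow> real"
  assumes U: "open U" "p \<in> U"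
    and L: "continuous_on U L" "L p = 0" and H: "continuous_on U H" "H p < 0" and K: "continuous_on U K"
  shows "(\<exists>\<epsilon>>0. \<forall>\<^sub>F q in nhds p. \<forall>l\<in>{0<..<\<epsilon>}. L q - 2 * l * H q + l\<^sup>2 * K q \<noteq> 0)
    \<longleftrightarrow> (\<forall>\<^sub>F q in nhds p. L q \<ge> 0)"
proof -
  \<comment> \<open>Near \<open>p\<close>, \<open>- H q > c / 2\<close> and
    \<open>\<bar>K q\<bar> < M\<close>. For \<open>l > 0\<close> the part of the polynomial
    depending on \<open>l\<close> then exceeds \<open>l * c - l\<^sup>2 * M\<close>, which is
    positive for \<open>l < c / M\<close>.\<close>
  define c where "c = - H p"
  define M where "M = \<bar>K p\<bar> + 1"
  have cM: "c > 0" "M > 0" using H by (auto simp: c_def M_def)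
  have tends: "(g \<longlongrightarrow> g p) (nhds p)" if "continuous_on U g" for g :: "'a \<Rightarrow> real"
    using that U continuous_on_eq_continuous_at by (metis isCont_def tendsto_at_iff_tendsto_nhds)
  have Hev: "\<forall>\<^sub>F q in nhds p. - H q > c / 2"
    using order_tendstoD(1)[OF tendsto_minus[OF tends[OF H(1)]], of "c/2"] cM by (simp add: c_def)
  have Kev: "\<forall>\<^sub>F q in nhds p. \<bar>K q\<bar> < M"
    using order_tendstoD(2)[OF tendsto_rabs[OF tends[OF K]], of M] by (simp add: M_def)
  have est: "L + (l * c - l\<^sup>2 * M) < L - 2 * l * H + l\<^sup>2 * K"
    if "0 < l" "- H > c / 2" "\<bar>K\<bar> < M" for L H K l :: real
  proof -
    have "l * c < l * (2 * (-H))" using that by (intro mult_strict_left_mono) auto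
    moreover have "l\<^sup>2 * (-M) < l\<^sup>2 * K" using that by (intro mult_strict_left_mono) auto
    ultimately show ?thesis by (simp add: algebra_simps)
  qed
  have pos: "l * c - l\<^sup>2 * M > 0" if "0 < l" "l < c / M" for l
    using that cM by (simp add: power2_eq_square field_simps)
  show ?thesis
  proof
    assume "\<exists>\<epsilon>>0. \<forall>\<^sub>F q in nhds p. \<forall>l\<in>{0<..<\<epsilon>}. L q - 2 * l * H q + l\<^sup>2 * K q \<noteq> 0"
    then obtain \<epsilon> where \<epsilon>: "\<epsilon> > 0"
      and nz: "\<forall>\<^sub>F q in nhds p. \<forall>l\<in>{0<..<\<epsilon>}. L q - 2 * l * H q + l\<^sup>2 * K q \<noteq> 0" by blast
    \<comment> \<open>This \<open>l\<close> is fixed before \<open>q\<close>. By continuity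
      \<open>L q\<close> is then close enough to 0 for the polynomial to be positive at
      \<open>l\<close>.\<close>
    define l where "l = min \<epsilon> (c / M) / 2"
    have l: "0 < l" "l < \<epsilon>" "l < c / M" using \<epsilon> cM by (auto simp: l_def min_def field_simps)
    have "\<forall>\<^sub>F q in nhds p. L q > - (l * c - l\<^sup>2 * M)"
      using order_tendstoD(1)[OF tends[OF L(1)]] L(2) pos[OF l(1,3)] by simp
    then show "\<forall>\<^sub>F q in nhds p. L q \<ge> 0"
      using nz Hev Kev
    proof eventually_elim
      case (elim q)
      let ?G = "\<lambda>l. L q - 2 * l * H q + l\<^sup>2 * K q"
      show ?case
      proof (rule ccontr)
        assume "\<not> L q \<ge> 0"
        moreover have "?G l > 0" using est[OF l(1) elim(3,4), of "L q"] elim(1) by linarith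
        moreover have "continuous_on {0..l} ?G" by (intro continuous_intros)
        \<comment> \<open>The polynomial equals \<open>L q < 0\<close> at 0 and is positive at
          \<open>l\<close>, so it has a root; that root is not 0 and hence lies in the forbidden
          interval.\<close>
        ultimately obtain s where s: "0 \<le> s" "s \<le> l" "?G s = 0"
          using IVT'[of ?G 0 0 l] l by auto
        then have "s \<noteq> 0" using \<open>\<not> L q \<ge> 0\<close> by auto
        then show False using s l elim(2) by force
      qed
    qed
  next
    assume "\<forall>\<^sub>F q in nhds p. L q \<ge> 0"
    then have "\<forall>\<^sub>F q in nhds p. \<forall>l\<in>{0<..<c/M}. L q - 2 * l * H q + l\<^sup>2 * K q \<noteq> 0"
      using Hev Kev
    proof eventually_elim
      case (elim q)
      show ?case
      proof
        fix l assume "l \<in> {0<..<c/M}"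
        then show "L q - 2 * l * H q + l\<^sup>2 * K q \<noteq> 0"
          using est[of l "H q" "K q" "L q"] pos[of l] elim by auto
      qed
    qed
    then show "\<exists>\<epsilon>>0. \<forall>\<^sub>F q in nhds p. \<forall>l\<in>{0<..<\<epsilon>}. L q - 2 * l * H q + l\<^sup>2 * K q \<noteq> 0"
      using cM by (intro exI[of _ "c/M"]) auto
  qed
qed

subsection \<open>Jacobians and continuity\<close>

lemma column_jacobian: "column j (jacobian f (at q)) = frechet_derivative f (at q) (axis j 1)"
  by (simp add: jacobian_def matrix_def column_def vec_eq_iff)

lemma jacobian_mult_vec:
  fixes f :: "real^'n \<Rightarrow> real^'m"
  assumes "f differentiable at q"
  shows "jacobian f (at q) *v h = frechet_derivative f (at q) h"
  using assms by (simp add: jacobian_def linear_frechet_derivative matrix_works)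

lemma jacobian_eqI:
  fixes f :: "real^'n \<Rightarrow> real^'m"
  assumes "(f has_derivative (\<lambda>h. M *v h)) (at q)"
  shows "jacobian f (at q) = M"
  unfolding jacobian_def frechet_derivative_at[OF assms, symmetric]
  by simp

lemma smooth_on_differentiable:
  assumes "smooth_on S f" "q \<in> S"
  shows "f differentiable at q" "(\<lambda>r. frechet_derivative f (at r) v) differentiable at q"
proof -
  have "higher_differentiable_on S f (Suc (Suc 0))" using assms(1) unfolding smooth_on_def by blast
  then show "f differentiable at q" "(\<lambda>r. frechet_derivative f (at r) v) differentiable at q"
    using assms(2) by auto
qed

lemma smooth_on_continuous:
  assumes "smooth_on S f"
  shows "continuous_on S f" "continuous_on S (\<lambda>r. frechet_derivative f (at r) v)"
proof -
  have "higher_differentiable_on S f 0" "higher_differentiable_on S f (Suc 0)"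
    using assms unfolding smooth_on_def by blast+
  then show "continuous_on S f" "continuous_on S (\<lambda>r. frechet_derivative f (at r) v)" by auto
qed

lemma continuous_on_matrixI:
  fixes M :: "'a::topological_space \<Rightarrow> real^'n^'m"
  assumes "\<And>i j. continuous_on S (\<lambda>q. M q $ i $ j)"
  shows "continuous_on S M"
proof -
  have "continuous_on S (\<lambda>q. \<chi> i j. M q $ i $ j)" by (intro continuous_on_vec_lambda assms)
  then show ?thesis by simp
qed

lemma continuous_on_matrix_mult:
  fixes A :: "'a::topological_space \<Rightarrow> real^'n^'m" and B :: "'a \<Rightarrow> real^'k^'n"
  assumes "continuous_on S A" "continuous_on S B"
  shows "continuous_on S (\<lambda>q. A q ** B q)"
  unfolding matrix_matrix_mult_def by (intro continuous_on_vec_lambda continuous_intros assms)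

lemma continuous_on_transpose:
  fixes A :: "'a::topological_space \<Rightarrow> real^'n^'m"
  assumes "continuous_on S A"
  shows "continuous_on S (\<lambda>q. transpose (A q))"
  unfolding transpose_def by (intro continuous_on_vec_lambda continuous_intros assms)

lemma continuous_on_column:
  fixes A :: "'a::topological_space \<Rightarrow> real^'n^'m"
  assumes "continuous_on S A"
  shows "continuous_on S (\<lambda>q. column j (A q))"
  unfolding column_def by (intro continuous_on_vec_lambda continuous_intros assms)

lemma continuous_on_adj2:
  fixes A :: "'a::topological_space \<Rightarrow> real^2^2"
  assumes "continuous_on S A"
  shows "continuous_on S (\<lambda>q. adj2 (A q))"
proof (rule continuous_on_matrixI)
  fix i j :: 2
  show "continuous_on S (\<lambda>q. adj2 (A q) $ i $ j)"
    using exhaust_2[of i] exhaust_2[of j]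
    by (elim disjE) (auto simp: adj2_def intro!: continuous_intros assms)
qed

lemma continuous_on_det_2:
  fixes A :: "'a::topological_space \<Rightarrow> real^2^2"
  assumes "continuous_on S A"
  shows "continuous_on S (\<lambda>q. det (A q))"
  unfolding det_2 by (intro continuous_intros assms)

lemma continuous_on_trace:
  fixes A :: "'a::topological_space \<Rightarrow> real^'n^'n"
  assumes "continuous_on S A"
  shows "continuous_on S (\<lambda>q. trace (A q))"
  unfolding trace_def by (intro continuous_intros assms)

lemma continuous_on_matrix_inv_2:
  fixes A :: "'a::topological_space \<Rightarrow> real^2^2"
  assumes "continuous_on S A" "\<And>q. q \<in> S \<Longrightarrow> det (A q) \<noteq> 0"
  shows "continuous_on S (\<lambda>q. matrix_inv (A q))"
proof -
  have "continuous_on S (\<lambda>q. (1 / det (A q)) *\<^sub>R adj2 (A q))"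
    using assms by (intro continuous_intros continuous_on_adj2 continuous_on_det_2) auto
  then show ?thesis
    by (rule continuous_on_eq) (simp add: assms matrix_inv_eq_adj2)
qed

subsection \<open>Surfaces with a tangent moving basis\<close>

locale tmb_surface =
  fixes U :: "(real^2) set" and x :: "real^2 \<Rightarrow> real^3" and \<Omega> :: "real^2 \<Rightarrow> real^2^3"
  assumes open_U: "open U" and smooth_x: "smooth_on U x" and tmb: "tangent_moving_basis U x \<Omega>"
begin

abbreviation "D f q \<equiv> frechet_derivative f (at q)"

section \<open>The cross product of the basis, the unit normal and their derivatives\<close>

lemma smooth_basis: "smooth_on U \<Omega>"
  using tmb by (simp add: tangent_moving_basis_def)

lemma columns_cross_nonzero: "columns_cross (\<Omega> q) \<noteq> 0" if "q \<in> U"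
proof
  let ?a = "column 1 (\<Omega> q)" and ?b = "column 2 (\<Omega> q)"
  assume "columns_cross (\<Omega> q) = 0"
  then have col: "?a = 0 \<or> ?b = 0 \<or> (\<exists>k. ?b = k *\<^sub>R ?a)"
    by (simp add: cross_eq_0 collinear_lemma)
  \<comment> \<open>The columns are swapped so that \<open>independent_insert\<close> asks whether
    \<open>?b\<close> lies in the span of \<open>?a\<close>, matching the collinear cases.\<close>
  have "independent {?b, ?a}" "?a \<noteq> ?b"
    using tmb that by (auto simp: tangent_moving_basis_def insert_commute)
  then show False using col
    by (auto simp: independent_insert dependent_zero span_singleton split: if_splits)
qed

lemma columns_cross_orthogonal_tangent:
  assumes "q \<in> U"
  shows "columns_cross (\<Omega> q) \<bullet> column j (jacobian x (at q)) = 0"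
proof -
  have "column j (jacobian x (at q)) \<in> span {column 1 (\<Omega> q), column 2 (\<Omega> q)}"
    using tmb assms exhaust_2[of j] by (auto simp: tangent_moving_basis_def)
  then have "orthogonal (columns_cross (\<Omega> q)) (column j (jacobian x (at q)))"
    by (rule orthogonal_to_span) (auto simp: orthogonal_cross)
  then show ?thesis by (simp add: orthogonal_def)
qed

definition cross_deriv :: "real^2 \<Rightarrow> real^2 \<Rightarrow> real^3" where
  "cross_deriv q h = cross3 (column 1 (\<Omega> q)) (column 2 (D \<Omega> q h))
     + cross3 (column 1 (D \<Omega> q h)) (column 2 (\<Omega> q))"

lemma has_derivative_cross_basis:
  assumes "q \<in> U"
  shows "((\<lambda>r. columns_cross (\<Omega> r)) has_derivative cross_deriv q) (at q)"
proof -
  have "(\<Omega> has_derivative D \<Omega> q) (at q)"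
    using smooth_on_differentiable(1)[OF smooth_basis assms] frechet_derivative_works by blast
  moreover have "bounded_linear (column j :: real^2^3 \<Rightarrow> real^3)" for j
    unfolding linear_conv_bounded_linear[symmetric]
    by (intro linearI) (simp_all add: column_def vec_eq_iff)
  ultimately have "((\<lambda>r. column j (\<Omega> r)) has_derivative (\<lambda>h. column j (D \<Omega> q h))) (at q)" for j
    using bounded_linear.has_derivative by blast
  then show ?thesis
    unfolding cross_deriv_def
    using bounded_bilinear.FDERIV[OF bilinear_cross[unfolded bilinear_conv_bounded_bilinear]] by blast
qed

text \<open>The derivative of \<open>c / norm c\<close> by the quotient rule. Its explicit form
  makes continuity and tangency visible.\<close>

definition normal_deriv :: "real^2 \<Rightarrow> real^2 \<Rightarrow> real^3" where
  "normal_deriv q h = (let c = columns_cross (\<Omega> q); c' = cross_deriv q h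
     in (1 / norm c) *\<^sub>R c' - (c \<bullet> c' / norm c ^ 3) *\<^sub>R c)"

lemma has_derivative_normal:
  assumes "q \<in> U"
  shows "(tmb_normal \<Omega> has_derivative normal_deriv q) (at q)"
proof -
  let ?c = "\<lambda>r. columns_cross (\<Omega> r)"
  note c = columns_cross_nonzero[OF assms]
  have "((\<lambda>r. norm (?c r)) has_derivative (\<lambda>h. sgn (?c q) \<bullet> cross_deriv q h)) (at q)"
    using has_derivative_compose[OF has_derivative_cross_basis[OF assms] has_derivative_norm[OF c]]
    by (simp add: inner_commute)
  then have "((\<lambda>r. inverse (norm (?c r)) *\<^sub>R ?c r) has_derivative normal_deriv q) (at q)"
    using c
    by (auto intro!: derivative_eq_intros has_derivative_cross_basis[OF assms] ext
        simp: normal_deriv_def Let_def sgn_div_norm field_simps power3_eq_cube)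
  then show ?thesis by (simp add: tmb_normal_def[abs_def])
qed

lemma D_normal: "q \<in> U \<Longrightarrow> D (tmb_normal \<Omega>) q = normal_deriv q"
  using has_derivative_normal frechet_derivative_at by metis

text \<open>The two terms of \<open>normal_deriv\<close> cancel against \<open>c\<close>. Hence the
  columns of the Jacobian of the normal satisfy the orthogonality hypotheses of
  \<open>gram_projection\<close>.\<close>

lemma columns_cross_orthogonal_normal_deriv:
  assumes "q \<in> U"
  shows "columns_cross (\<Omega> q) \<bullet> normal_deriv q h = 0"
  using columns_cross_nonzero[OF assms]
  by (simp add: normal_deriv_def Let_def inner_diff_right dot_square_norm power2_eq_square power3_eq_cube)

lemma continuous_on_jacobian_x: "continuous_on U (\<lambda>q. jacobian x (at q))"
proof (rule continuous_on_matrixI)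
  fix i j
  have "jacobian x (at q) $ i $ j = D x q (axis j 1) $ i" for q
    by (simp add: jacobian_def matrix_def)
  then show "continuous_on U (\<lambda>q. jacobian x (at q) $ i $ j)"
    using continuous_on_component[OF smooth_on_continuous(2)[OF smooth_x]] by simp
qed

lemma continuous_on_jacobian_normal: "continuous_on U (\<lambda>q. jacobian (tmb_normal \<Omega>) (at q))"
proof (rule continuous_on_matrixI)
  fix i j
  have "continuous_on U (\<lambda>q. normal_deriv q h)" for h
    unfolding normal_deriv_def cross_deriv_def Let_def
    using columns_cross_nonzero
    by (intro continuous_intros continuous_on_cross continuous_on_column smooth_on_continuous[OF smooth_basis]) auto
  then have "continuous_on U (\<lambda>q. normal_deriv q (axis j 1) $ i)"
    by (intro continuous_intros)
  then show "continuous_on U (\<lambda>q. jacobian (tmb_normal \<Omega>) (at q) $ i $ j)"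
    by (rule continuous_on_eq) (simp add: jacobian_def matrix_def D_normal)
qed

text \<open>Differentiating \<open>x\<^sub>u \<bullet> n = 0 = x\<^sub>v \<bullet> n\<close> reduces the symmetry to that of the second derivatives of \<open>x\<close>.\<close>

lemma second_form_symmetric:
  assumes q: "q \<in> U"
  shows "transpose (second_form x \<Omega> q) = second_form x \<Omega> q"
proof -
  have entry: "second_form x \<Omega> q $ i $ j = - (D x q (axis i 1) \<bullet> normal_deriv q (axis j 1))" for i j
    unfolding second_form_def D_normal[OF q, symmetric] column_jacobian[symmetric]
    by (simp add: matrix_matrix_mult_def transpose_def column_def inner_vec_def)
  let ?n = "tmb_normal \<Omega>" and ?e = "\<lambda>i::2. axis i (1::real)"
  have d2: "((\<lambda>r. D x r v) has_derivative D (\<lambda>r. D x r v) q) (at q)" for v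
    using smooth_on_differentiable(2)[OF smooth_x q] frechet_derivative_works by blast
  have d1: "(x has_derivative D x r) (at r)" if "r \<in> U" for r
    using smooth_on_differentiable(1)[OF smooth_x that] frechet_derivative_works by blast
  \<comment> \<open>Product rule for the function \<open>D x r (?e i) \<bullet> ?n r\<close>, which
    is identically 0 on \<open>U\<close>.\<close>
  have "D x q (?e i) \<bullet> normal_deriv q h + D (\<lambda>r. D x r (?e i)) q h \<bullet> ?n q = 0" for i h
  proof -
    have "((\<lambda>r. D x r (?e i) \<bullet> ?n r) has_derivative
      (\<lambda>h. D x q (?e i) \<bullet> normal_deriv q h + D (\<lambda>r. D x r (?e i)) q h \<bullet> ?n q)) (at q)"
      by (rule has_derivative_inner[OF d2 has_derivative_normal[OF q]])
    moreover have "((\<lambda>r. D x r (?e i) \<bullet> ?n r) has_derivative (\<lambda>h. 0)) (at q)"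
    proof (rule has_derivative_transform_within_open[OF has_derivative_const open_U q])
      fix r assume "r \<in> U"
      then show "0 = D x r (?e i) \<bullet> ?n r"
        using columns_cross_orthogonal_tangent[of r i]
        by (simp add: tmb_normal_def column_jacobian inner_commute)
    qed
    ultimately show ?thesis
      using has_derivative_unique by (metis (no_types, lifting))
  qed
  moreover have "D (\<lambda>r. D x r (?e i)) q (?e j) = D (\<lambda>r. D x r (?e j)) q (?e i)" for i j
    by (rule mixed_derivatives_commute[OF open_U q d1 d2 d2])
  ultimately have "second_form x \<Omega> q $ i $ j = second_form x \<Omega> q $ j $ i" for i j
    unfolding entry by (metis add_right_cancel)
  then show ?thesis by (simp add: transpose_def vec_eq_iff)
qed

section \<open>Factoring the Jacobians through the basis; singular points and parallel
  surfaces\<close>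

lemma gram_nonzero: "q \<in> U \<Longrightarrow> det (I_tmb \<Omega> q) \<noteq> 0"
  by (simp add: I_tmb_def det_gram columns_cross_nonzero)

lemma jacobian_x_decomposition:
  assumes "q \<in> U"
  shows "jacobian x (at q) = \<Omega> q ** transpose (Lambda_tmb x \<Omega> q)"
  unfolding Lambda_tmb_def I_tmb_def
  by (intro gram_projection[symmetric] columns_cross_nonzero columns_cross_orthogonal_tangent assms)

text \<open>This is the shape of \<open>Lambda_tmb\<close> with the normal in place of
  \<open>x\<close>, so \<open>gram_projection\<close> covers both.\<close>

lemma mu_tmb_alt:
  "mu_tmb \<Omega> q = transpose (jacobian (tmb_normal \<Omega>) (at q)) ** \<Omega> q ** matrix_inv (I_tmb \<Omega> q)"
proof -
  have "transpose (- A) = - transpose A" "- A ** B = - (A ** B)" for A B :: "real^2^2"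
    by (simp_all add: transpose_def matrix_matrix_mult_def vec_eq_iff sum_negf)
  then show ?thesis
    by (simp add: mu_tmb_def II_tmb_def matrix_transpose_mul)
qed

lemma jacobian_normal_decomposition:
  assumes "q \<in> U"
  shows "jacobian (tmb_normal \<Omega>) (at q) = \<Omega> q ** transpose (mu_tmb \<Omega> q)"
  unfolding mu_tmb_alt I_tmb_def
  by (rule gram_projection[symmetric])
    (simp_all add: columns_cross_nonzero assms column_jacobian D_normal columns_cross_orthogonal_normal_deriv)

lemma singular_set_eq: "singular_set U x = {q \<in> U. lambda_tmb x \<Omega> q = 0}"
proof -
  have "immersive_at x q \<longleftrightarrow> lambda_tmb x \<Omega> q \<noteq> 0" if q: "q \<in> U" for q
  proof -
    have "D x q = (*v) (jacobian x (at q))"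
      using jacobian_mult_vec[OF smooth_on_differentiable(1)[OF smooth_x q]] by auto
    then show ?thesis
      using smooth_on_differentiable(1)[OF smooth_x q] inj_mult_full_rank[OF columns_cross_nonzero[OF q]]
      by (simp add: immersive_at_def jacobian_x_decomposition[OF q] lambda_tmb_def)
  qed
  then show ?thesis by (auto simp: singular_set_def)
qed

lemma rank_parallel_iff:
  assumes q: "q \<in> U"
  shows "rank (jacobian (\<lambda>r. x r + l *\<^sub>R tmb_normal \<Omega> r) (at q)) = 2 \<longleftrightarrow>
    lambda_tmb x \<Omega> q - 2 * l * H_tmb x \<Omega> q + l\<^sup>2 * K_tmb \<Omega> q \<noteq> 0"
proof -
  let ?L = "Lambda_tmb x \<Omega> q" and ?m = "mu_tmb \<Omega> q"
  have "(x has_derivative (\<lambda>h. jacobian x (at q) *v h)) (at q)"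
    "(tmb_normal \<Omega> has_derivative (\<lambda>h. jacobian (tmb_normal \<Omega>) (at q) *v h)) (at q)"
    using smooth_on_differentiable(1)[OF smooth_x q] has_derivative_normal[OF q]
    by (auto simp: differentiable_def simp flip: jacobian_works)
  then have "((\<lambda>r. x r + l *\<^sub>R tmb_normal \<Omega> r) has_derivative
    (\<lambda>h. (jacobian x (at q) + l *\<^sub>R jacobian (tmb_normal \<Omega>) (at q)) *v h)) (at q)"
    by (auto intro!: derivative_eq_intros simp: matrix_vector_mult_add_rdistrib scaleR_matrix_vector_assoc)
  then have "jacobian (\<lambda>r. x r + l *\<^sub>R tmb_normal \<Omega> r) (at q)
    = jacobian x (at q) + l *\<^sub>R jacobian (tmb_normal \<Omega>) (at q)"
    by (rule jacobian_eqI)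
  also have "\<dots> = \<Omega> q ** transpose ?L + l *\<^sub>R (\<Omega> q ** transpose ?m)"
    by (simp add: jacobian_x_decomposition[OF q, symmetric] jacobian_normal_decomposition[OF q, symmetric])
  also have "\<dots> = \<Omega> q ** transpose (?L + l *\<^sub>R ?m)"
    by (simp add: matrix_matrix_mult_def transpose_def vec_eq_iff sum_2 algebra_simps)
  \<comment> \<open>Rank 2 is full column rank, that is injectivity, and this is decided by the
    determinant of the 2 by 2 factor.\<close>
  finally show ?thesis
    using full_rank_injective[of "\<Omega> q ** transpose (?L + l *\<^sub>R ?m)"]
      inj_mult_full_rank[OF columns_cross_nonzero[OF q], of "transpose (?L + l *\<^sub>R ?m)"]
    by (simp add: det_pencil lambda_tmb_def H_tmb_def K_tmb_def)
qed

section \<open>Fundamental forms and curvatures in terms of the basis\<close>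

lemma forms_decomposition:
  assumes q: "q \<in> U"
  shows "first_form x q = Lambda_tmb x \<Omega> q ** I_tmb \<Omega> q ** transpose (Lambda_tmb x \<Omega> q)"
    and "second_form x \<Omega> q = - (Lambda_tmb x \<Omega> q ** I_tmb \<Omega> q ** transpose (mu_tmb \<Omega> q))"
  unfolding first_form_def second_form_def I_tmb_def
  by (simp_all add: jacobian_x_decomposition[OF q] jacobian_normal_decomposition[OF q]
      matrix_transpose_mul matrix_mul_assoc)

lemma first_form_det:
  assumes q: "q \<in> U"
  shows "first_form x q $ 1 $ 1 * first_form x q $ 2 $ 2 - (first_form x q $ 1 $ 2)\<^sup>2
    = (lambda_tmb x \<Omega> q)\<^sup>2 * det (I_tmb \<Omega> q)"
proof -
  have "first_form x q $ 2 $ 1 = first_form x q $ 1 $ 2"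
    by (rule symmetric_matrix_entry) (simp add: first_form_def gram_symmetric)
  then have "first_form x q $ 1 $ 1 * first_form x q $ 2 $ 2 - (first_form x q $ 1 $ 2)\<^sup>2 = det (first_form x q)"
    by (simp add: det_2 power2_eq_square)
  then show ?thesis
    by (simp add: forms_decomposition[OF q] det_mul lambda_tmb_def power2_eq_square)
qed

text \<open>The numerator carries one factor \<open>lambda_tmb\<close> and the denominator two;
  \<open>det (I_tmb \<Omega> q)\<close> cancels.\<close>

lemma mean_curvature_eq:
  assumes q: "q \<in> U" and "lambda_tmb x \<Omega> q \<noteq> 0"
  shows "mean_curvature x \<Omega> q = H_tmb x \<Omega> q / lambda_tmb x \<Omega> q"
proof -
  have "second_form x \<Omega> q $ 1 $ 1 * first_form x q $ 2 $ 2 + second_form x \<Omega> q $ 2 $ 2 * first_form x q $ 1 $ 1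
    - 2 * second_form x \<Omega> q $ 1 $ 2 * first_form x q $ 1 $ 2
    = 2 * H_tmb x \<Omega> q * lambda_tmb x \<Omega> q * det (I_tmb \<Omega> q)"
    unfolding forms_decomposition[OF q]
    by (subst mean_numerator)
      (use second_form_symmetric[OF q] in \<open>simp_all add: forms_decomposition[OF q] I_tmb_def gram_symmetric
        H_tmb_def lambda_tmb_def\<close>)
  then show ?thesis
    unfolding mean_curvature_def Let_def first_form_det[OF q]
    using assms gram_nonzero[OF q] by (simp add: power2_eq_square)
qed

lemma gauss_curvature_eq:
  assumes q: "q \<in> U" and "lambda_tmb x \<Omega> q \<noteq> 0"
  shows "gauss_curvature x \<Omega> q = K_tmb \<Omega> q / lambda_tmb x \<Omega> q"
proof -
  have "second_form x \<Omega> q $ 1 $ 1 * second_form x \<Omega> q $ 2 $ 2 - (second_form x \<Omega> q $ 1 $ 2)\<^sup>2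
    = lambda_tmb x \<Omega> q * det (I_tmb \<Omega> q) * K_tmb \<Omega> q"
    unfolding forms_decomposition[OF q]
    by (subst gauss_numerator)
      (use second_form_symmetric[OF q] in \<open>simp_all add: forms_decomposition[OF q] lambda_tmb_def K_tmb_def\<close>)
  then show ?thesis
    unfolding gauss_curvature_def Let_def first_form_det[OF q]
    using assms gram_nonzero[OF q] by (simp add: power2_eq_square)
qed

section \<open>Continuity of the invariants\<close>

lemma continuous_on_I: "continuous_on U (I_tmb \<Omega>)"
  unfolding I_tmb_def[abs_def]
  by (intro continuous_on_matrix_mult continuous_on_transpose smooth_on_continuous[OF smooth_basis])

lemma continuous_on_Lambda: "continuous_on U (Lambda_tmb x \<Omega>)"
  unfolding Lambda_tmb_def[abs_def]
  by (intro continuous_on_matrix_mult continuous_on_transpose smooth_on_continuous[OF smooth_basis]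
      continuous_on_jacobian_x continuous_on_matrix_inv_2 continuous_on_I gram_nonzero)

lemma continuous_on_mu: "continuous_on U (mu_tmb \<Omega>)"
  unfolding mu_tmb_alt[abs_def]
  by (intro continuous_on_matrix_mult continuous_on_transpose smooth_on_continuous[OF smooth_basis]
      continuous_on_jacobian_normal continuous_on_matrix_inv_2 continuous_on_I gram_nonzero)

lemma continuous_on_invariants:
  "continuous_on U (lambda_tmb x \<Omega>)" "continuous_on U (H_tmb x \<Omega>)" "continuous_on U (K_tmb \<Omega>)"
  unfolding lambda_tmb_def[abs_def] H_tmb_def[abs_def] K_tmb_def[abs_def]
  by (intro continuous_intros continuous_on_det_2 continuous_on_trace continuous_on_matrix_mult
      continuous_on_adj2 continuous_on_Lambda continuous_on_mu)+

text \<open>Taking \<open>lambda_tmb\<close> squared out of the root produces its absolute value,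
  which the case distinction in \<open>k1\<close> and \<open>k2\<close> absorbs. The new numerators
  are continuous across the singular set.\<close>

lemma principal_curvature_eq:
  assumes q: "q \<in> U" and nz: "lambda_tmb x \<Omega> q \<noteq> 0"
  defines "\<rho> \<equiv> sqrt ((H_tmb x \<Omega> q)\<^sup>2 - lambda_tmb x \<Omega> q * K_tmb \<Omega> q)"
  shows "k1 x \<Omega> q = (H_tmb x \<Omega> q - \<rho>) / lambda_tmb x \<Omega> q"
    and "k2 x \<Omega> q = (H_tmb x \<Omega> q + \<rho>) / lambda_tmb x \<Omega> q"
proof -
  let ?l = "lambda_tmb x \<Omega> q"
  have "(mean_curvature x \<Omega> q)\<^sup>2 - gauss_curvature x \<Omega> q = ((H_tmb x \<Omega> q)\<^sup>2 - ?l * K_tmb \<Omega> q) / ?l\<^sup>2"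
    using nz by (simp add: mean_curvature_eq[OF q nz] gauss_curvature_eq[OF q nz] field_simps power2_eq_square)
  then have "sqrt ((mean_curvature x \<Omega> q)\<^sup>2 - gauss_curvature x \<Omega> q) = \<rho> / \<bar>?l\<bar>"
    by (simp add: \<rho>_def real_sqrt_divide)
  then show "k1 x \<Omega> q = (H_tmb x \<Omega> q - \<rho>) / ?l" "k2 x \<Omega> q = (H_tmb x \<Omega> q + \<rho>) / ?l"
    using nz by (auto simp: k1_def k2_def Let_def mean_curvature_eq[OF q nz] diff_divide_distrib add_divide_distrib)
qed

section \<open>The equivalences at a singular point\<close>

lemma eventually_nhds_within_open:
  assumes "p \<in> U"
  shows "(\<forall>\<^sub>F q in nhds p. P q) \<longleftrightarrow> (\<exists>V. open V \<and> p \<in> V \<and> V \<subseteq> U \<and> (\<forall>q\<in>V. P q))"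
proof
  assume "\<forall>\<^sub>F q in nhds p. P q"
  from eventually_conj[OF this eventually_nhds_in_open[OF open_U assms]]
  show "\<exists>V. open V \<and> p \<in> V \<and> V \<subseteq> U \<and> (\<forall>q\<in>V. P q)"
    unfolding eventually_nhds by blast
qed (auto simp: eventually_nhds)

lemma no_sign_change_iff:
  assumes "p \<in> U"
  shows "(\<exists>V. open V \<and> p \<in> V \<and> V \<subseteq> U \<and> no_sign_change_on f V)
    \<longleftrightarrow> (\<forall>\<^sub>F q in nhds p. f q \<ge> 0) \<or> (\<forall>\<^sub>F q in nhds p. f q \<le> 0)"
  unfolding no_sign_change_on_def eventually_nhds_within_open[OF assms] by blast

lemma diverges_iff_no_sign_change:
  assumes p: "p \<in> U" "lambda_tmb x \<Omega> p = 0"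
    and h: "continuous_on U h" "h p \<noteq> 0"
    and \<phi>: "\<And>q. q \<in> U \<Longrightarrow> lambda_tmb x \<Omega> q \<noteq> 0 \<Longrightarrow> \<phi> q = h q / lambda_tmb x \<Omega> q"
  shows "diverges_at_singularity U x \<phi> p \<longleftrightarrow>
    (\<exists>V. open V \<and> p \<in> V \<and> V \<subseteq> U \<and> no_sign_change_on (lambda_tmb x \<Omega>) V)"
proof -
  have "U - singular_set U x = {q \<in> U. lambda_tmb x \<Omega> q \<noteq> 0}" by (auto simp: singular_set_eq)
  moreover have "\<forall>\<^sub>F q in nhds p. lambda_tmb x \<Omega> q \<noteq> 0 \<longrightarrow> \<phi> q = h q / lambda_tmb x \<Omega> q"
    using eventually_nhds_in_open[OF open_U p(1)] by eventually_elim (simp add: \<phi>)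
  ultimately show ?thesis
    unfolding diverges_at_singularity_def no_sign_change_iff[OF p(1)]
    using quotient_divergence_iff[OF open_U p(1) continuous_on_invariants(1) p(2) h] by simp
qed

text \<open>For \<open>H_tmb\<close> negative at \<open>p\<close>, positive \<open>l\<close>
  correspond to \<open>lambda_tmb\<close> being nonnegative near \<open>p\<close> and negative
  \<open>l\<close> to its being nonpositive; for \<open>H_tmb\<close> positive the roles are
  exchanged.\<close>

lemma parallelly_smoothable_iff_no_sign_change:
  assumes p: "p \<in> U" "lambda_tmb x \<Omega> p = 0" and H: "H_tmb x \<Omega> p \<noteq> 0"
  shows "parallelly_smoothable_at U x \<Omega> p \<longleftrightarrow>
    (\<exists>V. open V \<and> p \<in> V \<and> V \<subseteq> U \<and> no_sign_change_on (lambda_tmb x \<Omega>) V)"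
proof -
  let ?L = "lambda_tmb x \<Omega>" and ?H = "H_tmb x \<Omega>" and ?K = "K_tmb \<Omega>"
  let ?G = "\<lambda>q l. ?L q - 2 * l * ?H q + l\<^sup>2 * ?K q"
  have nbhd: "(\<exists>V. open V \<and> p \<in> V \<and> V \<subseteq> U \<and> (\<forall>q\<in>V. \<forall>l\<in>B.
      rank (jacobian (\<lambda>r. x r + l *\<^sub>R tmb_normal \<Omega> r) (at q)) = 2))
    \<longleftrightarrow> (\<forall>\<^sub>F q in nhds p. \<forall>l\<in>B. ?G q l \<noteq> 0)" for B
    unfolding eventually_nhds_within_open[OF p(1), symmetric]
    by (intro eventually_subst eventually_mono[OF eventually_nhds_in_open[OF open_U p(1)]])
      (simp add: rank_parallel_iff)
  have smoothable: "parallelly_smoothable_at U x \<Omega> p \<longleftrightarrow>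
    (\<exists>\<epsilon>>0. \<forall>\<^sub>F q in nhds p. \<forall>l\<in>{0<..<\<epsilon>}. ?G q l \<noteq> 0) \<or>
    (\<exists>\<epsilon>>0. \<forall>\<^sub>F q in nhds p. \<forall>l\<in>{-\<epsilon><..<0}. ?G q l \<noteq> 0)"
    unfolding parallelly_smoothable_at_def nbhd[symmetric] by blast
  have flip: "(\<forall>l\<in>{-\<epsilon><..<0}. P l) \<longleftrightarrow> (\<forall>l\<in>{0<..<\<epsilon>}. P (- l))" for \<epsilon> :: real and P
  proof
    assume *: "\<forall>l\<in>{0<..<\<epsilon>}. P (- l)"
    show "\<forall>l\<in>{-\<epsilon><..<0}. P l"
    proof
      fix l assume "l \<in> {-\<epsilon><..<0}"
      then show "P l" using *[rule_format, of "- l"] by auto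
    qed
  qed auto
  note cont = continuous_on_invariants
  show ?thesis
    unfolding smoothable no_sign_change_iff[OF p(1)] flip
  proof (cases "?H p < 0")
    case True
    have "(\<exists>\<epsilon>>0. \<forall>\<^sub>F q in nhds p. \<forall>l\<in>{0<..<\<epsilon>}. ?G q l \<noteq> 0) \<longleftrightarrow> (\<forall>\<^sub>F q in nhds p. ?L q \<ge> 0)"
      by (rule pencil_nonzero_iff[OF open_U p(1) cont(1) p(2) cont(2) True cont(3)])
    \<comment> \<open>The polynomial at \<open>-l\<close>, multiplied by -1, is the model polynomial
      for \<open>- ?L\<close>, \<open>?H\<close> and \<open>- ?K\<close>.\<close>
    moreover have "(\<exists>\<epsilon>>0. \<forall>\<^sub>F q in nhds p. \<forall>l\<in>{0<..<\<epsilon>}. ?G q (-l) \<noteq> 0) \<longleftrightarrow> (\<forall>\<^sub>F q in nhds p. ?L q \<le> 0)"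
    proof -
      have "?G q (-l) \<noteq> 0 \<longleftrightarrow> - ?L q - 2 * l * ?H q + l\<^sup>2 * (- ?K q) \<noteq> 0" for q l
        by (auto simp: algebra_simps)
      then show ?thesis
        using pencil_nonzero_iff[OF open_U p(1) continuous_on_minus[OF cont(1)] _ cont(2) True
            continuous_on_minus[OF cont(3)]] p(2) by simp
    qed
    ultimately show "(\<exists>\<epsilon>>0. \<forall>\<^sub>F q in nhds p. \<forall>l\<in>{0<..<\<epsilon>}. ?G q l \<noteq> 0) \<or>
      (\<exists>\<epsilon>>0. \<forall>\<^sub>F q in nhds p. \<forall>l\<in>{0<..<\<epsilon>}. ?G q (-l) \<noteq> 0) \<longleftrightarrow>
      (\<forall>\<^sub>F q in nhds p. ?L q \<ge> 0) \<or> (\<forall>\<^sub>F q in nhds p. ?L q \<le> 0)" by simp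
  next
    case False
    then have neg: "- ?H p < 0" using H by simp
    have "(\<exists>\<epsilon>>0. \<forall>\<^sub>F q in nhds p. \<forall>l\<in>{0<..<\<epsilon>}. ?G q (-l) \<noteq> 0) \<longleftrightarrow> (\<forall>\<^sub>F q in nhds p. ?L q \<ge> 0)"
      using pencil_nonzero_iff[OF open_U p(1) cont(1) p(2) continuous_on_minus[OF cont(2)] neg cont(3)] by simp
    moreover have "(\<exists>\<epsilon>>0. \<forall>\<^sub>F q in nhds p. \<forall>l\<in>{0<..<\<epsilon>}. ?G q l \<noteq> 0) \<longleftrightarrow> (\<forall>\<^sub>F q in nhds p. ?L q \<le> 0)"
    proof -
      have "?G q l \<noteq> 0 \<longleftrightarrow> - ?L q - 2 * l * (- ?H q) + l\<^sup>2 * (- ?K q) \<noteq> 0" for q l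
        by (auto simp: algebra_simps)
      then show ?thesis
        using pencil_nonzero_iff[OF open_U p(1) continuous_on_minus[OF cont(1)] _
            continuous_on_minus[OF cont(2)] neg continuous_on_minus[OF cont(3)]] p(2) by simp
    qed
    ultimately show "(\<exists>\<epsilon>>0. \<forall>\<^sub>F q in nhds p. \<forall>l\<in>{0<..<\<epsilon>}. ?G q l \<noteq> 0) \<or>
      (\<exists>\<epsilon>>0. \<forall>\<^sub>F q in nhds p. \<forall>l\<in>{0<..<\<epsilon>}. ?G q (-l) \<noteq> 0) \<longleftrightarrow>
      (\<forall>\<^sub>F q in nhds p. ?L q \<ge> 0) \<or> (\<forall>\<^sub>F q in nhds p. ?L q \<le> 0)" by blast
  qed
qed

end

theorem theorem4p4:
  fixes U :: "(real^2) set" and x :: "real^2 \<Rightarrow> real^3" and \<Omega> :: "real^2 \<Rightarrow> real^2^3" and p :: "real^2"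
  assumes "open U"
    and "wavefront U x"
    and "tangent_moving_basis U x \<Omega>"
    and "p \<in> singular_set U x"
    and "rank (jacobian x (at p)) = 1"
    and "K_tmb \<Omega> p = 0"
  shows "(H_tmb x \<Omega> p < 0 \<longrightarrow>
           (parallelly_smoothable_at U x \<Omega> p \<longleftrightarrow> diverges_at_singularity U x (mean_curvature x \<Omega>) p) \<and>
           (parallelly_smoothable_at U x \<Omega> p \<longleftrightarrow> diverges_at_singularity U x (k1 x \<Omega>) p) \<and>
           (parallelly_smoothable_at U x \<Omega> p \<longleftrightarrow>
              (\<exists>V. open V \<and> p \<in> V \<and> V \<subseteq> U \<and> no_sign_change_on (lambda_tmb x \<Omega>) V))) \<and>
         (H_tmb x \<Omega> p > 0 \<longrightarrow>
           (parallelly_smoothable_at U x \<Omega> p \<longleftrightarrow> diverges_at_singularity U x (mean_curvature x \<Omega>) p) \<and>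
           (parallelly_smoothable_at U x \<Omega> p \<longleftrightarrow> diverges_at_singularity U x (k2 x \<Omega>) p) \<and>
           (parallelly_smoothable_at U x \<Omega> p \<longleftrightarrow>
              (\<exists>V. open V \<and> p \<in> V \<and> V \<subseteq> U \<and> no_sign_change_on (lambda_tmb x \<Omega>) V)))"
proof -
  interpret tmb_surface U x \<Omega>
    using assms by unfold_locales (auto simp: wavefront_def frontal_def)
  have p: "p \<in> U" "lambda_tmb x \<Omega> p = 0" using assms(4) by (auto simp: singular_set_eq)
  let ?H = "H_tmb x \<Omega>" and ?\<rho> = "\<lambda>q. sqrt ((H_tmb x \<Omega> q)\<^sup>2 - lambda_tmb x \<Omega> q * K_tmb \<Omega> q)"
  have cont: "continuous_on U (\<lambda>q. ?H q - ?\<rho> q)" "continuous_on U (\<lambda>q. ?H q + ?\<rho> q)"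
    by (intro continuous_intros continuous_on_invariants)+
  \<comment> \<open>Since \<open>lambda_tmb\<close> vanishes at \<open>p\<close>, the numerators
    there are \<open>?H p - \<bar>?H p\<bar>\<close> for \<open>k1\<close> and
    \<open>?H p + \<bar>?H p\<bar>\<close> for \<open>k2\<close>. The first is nonzero exactly for
    \<open>?H p < 0\<close>, the second exactly for \<open>?H p > 0\<close>.\<close>
  have \<rho>: "?\<rho> p = \<bar>?H p\<bar>" using p by simp
  have k1: "?H p < 0 \<Longrightarrow> diverges_at_singularity U x (k1 x \<Omega>) p \<longleftrightarrow>
      (\<exists>V. open V \<and> p \<in> V \<and> V \<subseteq> U \<and> no_sign_change_on (lambda_tmb x \<Omega>) V)"
    by (rule diverges_iff_no_sign_change[OF p cont(1)]) (simp_all add: \<rho> principal_curvature_eq)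
  have k2: "?H p > 0 \<Longrightarrow> diverges_at_singularity U x (k2 x \<Omega>) p \<longleftrightarrow>
      (\<exists>V. open V \<and> p \<in> V \<and> V \<subseteq> U \<and> no_sign_change_on (lambda_tmb x \<Omega>) V)"
    by (rule diverges_iff_no_sign_change[OF p cont(2)]) (simp_all add: \<rho> principal_curvature_eq)
  have H: "?H p \<noteq> 0 \<Longrightarrow> diverges_at_singularity U x (mean_curvature x \<Omega>) p \<longleftrightarrow>
      (\<exists>V. open V \<and> p \<in> V \<and> V \<subseteq> U \<and> no_sign_change_on (lambda_tmb x \<Omega>) V)"
    by (rule diverges_iff_no_sign_change[OF p continuous_on_invariants(2)]) (simp_all add: mean_curvature_eq)
  show ?thesis
    using k1 k2 H parallelly_smoothable_iff_no_sign_change[OF p] by auto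
qed

end
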